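(* Let $(T,d)$ be a metric space with $D(T)<\infty$ and $m$ a Borel probability measure on $T$ with $\operatorname{supp}(m)=T$. Let $a,b\ge0$, $\varphi\in\mathcal{G}_{a,b}$, $R\ge2$, and let $k_0\in\mathbb{Z}$ be the integer with $R^{k_0}\le\varphi^{-1}(1)<R^{k_0+1}$. Set $r_{k_0}(x):=D(T)$ for $x\in T$, and for integers $k>k_0$ and $x\in T$ set $$r_k(x):=\min\left\{\varepsilon\ge0:\varphi^{-1}\left(\frac{1}{m(B(x,\varepsilon))}\right)\le R^k\right\}.$$ Then for every integer $k\ge k_0$ the function $r_k:T\to\mathbb{R}$ is $1$-Lipschitz.
   Context: $B(x,\varepsilon)=\{y\in T:d(x,y)\le\varepsilon\}$ is the closed ball and $D(T)=\sup\{d(s,t):s,t\in T\}$ the diameter of $T$. For $a,b\ge0$, $\mathcal{G}_{a,b}$ is the class of all functions $\varphi:\mathbb{R}_+\to\mathbb{R}$ that are (strictly) increasing and continuous, satisfy $\varphi(0)=0$, and satisfy $x\le a+b\frac{\varphi(xy)}{\varphi(y)}$ for all $x\ge 0$, $y\ge\varphi^{-1}(1)$; it is understood that the inverse $\varphi^{-1}$ is defined on $[0,\infty)$. In the definition of $r_k$, values of $\varepsilon$ with $m(B(x,\varepsilon))=0$ (possible only for $\varepsilon=0$) are regarded as giving $\varphi^{-1}(1/0)=+\infty$. *)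

theory Defs
  imports "HOL-Probability.Probability"
begin

definition inv_plus :: "(real \<Rightarrow> real) \<Rightarrow> real \<Rightarrow> real" where
  "inv_plus \<phi> = the_inv_into {0..} \<phi>"

(* Only the restriction of \<phi> to {0..} matters.  The image condition says that
   the inverse is defined on all of {0..}. *)
definition class_G :: "real \<Rightarrow> real \<Rightarrow> (real \<Rightarrow> real) set" where
  "class_G a b = {\<phi>. strict_mono_on {0..} \<phi> \<and> continuous_on {0..} \<phi> \<and> \<phi> 0 = 0 \<and>
     \<phi> ` {0..} = {0..} \<and>
     (\<forall>x\<ge>0. \<forall>y\<ge>inv_plus \<phi> 1. x \<le> a + b * (\<phi> (x * y) / \<phi> y))}"

definition measure_support :: "'a::topological_space measure \<Rightarrow> 'a set" where
  "measure_support m = {x. \<forall>U. open U \<and> x \<in> U \<longrightarrow> emeasure m U > 0}"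

(* inv_plus \<phi> (1 / p), with the convention that it is infinite for p = 0 *)
definition inv_recip :: "(real \<Rightarrow> real) \<Rightarrow> real \<Rightarrow> ereal" where
  "inv_recip \<phi> p = (if p = 0 then \<infinity> else ereal (inv_plus \<phi> (1 / p)))"

(* The metric space is the whole type 'a.  The value is only meaningful for k \<ge> k0;
   LEAST denotes a genuine minimum, not an infimum. *)
definition radius ::
  "'a::metric_space measure \<Rightarrow> (real \<Rightarrow> real) \<Rightarrow> real \<Rightarrow> int \<Rightarrow> int \<Rightarrow> 'a \<Rightarrow> real" where
  "radius m \<phi> R k0 k x =
     (if k = k0 then diameter (UNIV :: 'a set)
      else (LEAST \<epsilon>. \<epsilon> \<ge> 0 \<and> inv_recip \<phi> (measure m (cball x \<epsilon>)) \<le> ereal (R powi k)))"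

end

theory Submission
  imports Defs
begin

text \<open>For \<open>k > k0\<close> the condition defining \<open>r_k(x)\<close> says that \<open>m(B(x,\<epsilon>)) \<ge> q\<close> for the
  constant \<open>q = 1/\<phi>(R^k) \<in> (0,1)\<close>. Closed balls decrease to \<open>B(x,\<epsilon>)\<close> as the radius decreases
  to \<open>\<epsilon>\<close>, so continuity of \<open>m\<close> from above shows that the minimum is attained. Since
  \<open>B(x,\<epsilon>) \<subseteq> B(y,\<epsilon> + d(x,y))\<close>, adding \<open>d(x,y)\<close> to an admissible radius at \<open>x\<close> gives one
  at \<open>y\<close>, whence the Lipschitz bound.\<close>

text \<open>A point whose distance from \<open>x\<close> is at most \<open>s + 1 / (n + 1)\<close>
  for every \<open>n\<close> has distance at most \<open>s\<close>, so these decreasing closed balls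
  intersect in exactly \<open>cball x s\<close>, and continuity from above of a finite measure
  applies.\<close>

lemma measure_cball_LIMSEQ_from_above:
  fixes m :: "'a::metric_space measure"
  assumes "finite_measure m" and sets: "sets m = sets borel"
  shows "(\<lambda>n. measure m (cball x (s + 1 / real (Suc n)))) \<longlonglongrightarrow> measure m (cball x s)"
proof -
  interpret finite_measure m by fact
  have eq: "(\<Inter>n. cball x (s + 1 / real (Suc n))) = cball x s"
  proof (intro equalityI subsetI)
    fix y assume "y \<in> (\<Inter>n. cball x (s + 1 / real (Suc n)))"
    then have le: "dist x y \<le> s + 1 / real (Suc n)" for n
      by auto
    have "(\<lambda>n. s + 1 / real (Suc n)) \<longlonglongrightarrow> s + 0"
      by (intro tendsto_intros LIMSEQ_Suc lim_1_over_n)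
    then have "dist x y \<le> s + 0"
      by (rule LIMSEQ_le_const) (use le in blast)
    then show "y \<in> cball x s" by simp
  next
    fix y assume "y \<in> cball x s"
    then show "y \<in> (\<Inter>n. cball x (s + 1 / real (Suc n)))"
      by (auto intro: order_trans)
  qed
  have "decseq (\<lambda>n. cball x (s + 1 / real (Suc n)))"
    by (intro antimonoI subset_cball add_left_mono) (simp add: frac_le)
  moreover have "range (\<lambda>n. cball x (s + 1 / real (Suc n))) \<subseteq> sets m"
    by (auto simp: sets)
  ultimately have "(\<lambda>n. measure m (cball x (s + 1 / real (Suc n))))
      \<longlonglongrightarrow> measure m (\<Inter>n. cball x (s + 1 / real (Suc n)))"
    by (intro finite_Lim_measure_decseq) auto
  then show ?thesis by (simp only: eq)
qed

text \<open>Every radius strictly above the infimum exceeds an admissible one and so is admissible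
  by monotonicity; letting it decrease to the infimum preserves the bound \<open>q\<close>. The
  radius \<open>e0\<close> only witnesses that the set is nonempty.\<close>

lemma Inf_radius_attained:
  fixes m :: "'a::metric_space measure"
  assumes "finite_measure m" and sets: "sets m = sets borel"
    and "e0 \<ge> 0" and "q \<le> measure m (cball x e0)"
  shows "Inf {\<epsilon>. \<epsilon> \<ge> 0 \<and> q \<le> measure m (cball x \<epsilon>)} \<in> {\<epsilon>. \<epsilon> \<ge> 0 \<and> q \<le> measure m (cball x \<epsilon>)}"
    (is "Inf ?S \<in> _")
proof -
  interpret finite_measure m by fact
  have ne: "?S \<noteq> {}" using assms(3,4) by blast
  have bdd: "bdd_below ?S" by (rule bdd_belowI[of _ 0]) auto
  have "q \<le> measure m (cball x (Inf ?S + 1 / real (Suc n)))" for n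
  proof -
    have "Inf ?S < Inf ?S + 1 / real (Suc n)" by simp
    then obtain e where e: "e \<in> ?S" "e < Inf ?S + 1 / real (Suc n)"
      using cInf_less_iff[OF ne bdd] by blast
    then have "measure m (cball x e) \<le> measure m (cball x (Inf ?S + 1 / real (Suc n)))"
      by (intro finite_measure_mono subset_cball) (auto simp: sets)
    with e(1) show ?thesis by simp
  qed
  then have "q \<le> measure m (cball x (Inf ?S))"
    by (intro LIMSEQ_le_const[OF measure_cball_LIMSEQ_from_above[OF assms(1,2)]]) blast
  moreover have "0 \<le> Inf ?S" by (rule cInf_greatest[OF ne]) simp
  ultimately show ?thesis by simp
qed

lemma lipschitz_least_radius:
  fixes m :: "'a::metric_space measure"
  assumes bounded: "bounded (UNIV :: 'a set)" and "prob_space m"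
    and sets: "sets m = sets borel" and "q \<le> 1"
  shows "1-lipschitz_on UNIV (\<lambda>x. LEAST \<epsilon>. \<epsilon> \<ge> 0 \<and> q \<le> measure m (cball x \<epsilon>))"
proof -
  interpret prob_space m by fact
  define P where "P = (\<lambda>x \<epsilon>. \<epsilon> \<ge> 0 \<and> q \<le> measure m (cball x \<epsilon>))"
  define r where "r = (\<lambda>x. LEAST \<epsilon>. P x \<epsilon>)"
  have space: "space m = UNIV" using sets_eq_imp_space_eq[OF sets] by simp
  \<comment> \<open>An admissible radius exists: the ball whose radius is the diameter is the whole
    space, of measure \<open>1\<close>, and \<open>q\<close> is at most \<open>1\<close>.\<close>
  have "P x (diameter (UNIV :: 'a set))" for x
  proof -
    have "cball x (diameter (UNIV :: 'a set)) = space m"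
      using diameter_bounded_bound[OF bounded] space by auto
    then show ?thesis
      using \<open>q \<le> 1\<close> diameter_ge_0[OF bounded] by (simp add: P_def prob_space)
  qed
  then have Inf_P: "P x (Inf {\<epsilon>. P x \<epsilon>})" for x
    using Inf_radius_attained[OF finite_measure_axioms sets, of _ q x] by (auto simp: P_def)
  have Inf_le: "Inf {\<epsilon>. P x \<epsilon>} \<le> \<epsilon>" if "P x \<epsilon>" for x \<epsilon>
    using that by (intro cInf_lower bdd_belowI[of _ 0]) (auto simp: P_def)
  \<comment> \<open>\<open>LEAST\<close> is informative only when a minimum exists; the attained
    infimum supplies it.\<close>
  have r_eq: "r x = Inf {\<epsilon>. P x \<epsilon>}" for x
    unfolding r_def by (intro Least_equality Inf_P Inf_le)
  have P_r: "P x (r x)" for x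
    unfolding r_eq by (rule Inf_P)
  have r_le: "r x \<le> \<epsilon>" if "P x \<epsilon>" for x \<epsilon>
    unfolding r_eq using that by (rule Inf_le)
  have bound: "r y \<le> r x + dist x y" for x y
  proof (rule r_le)
    have "cball x (r x) \<subseteq> cball y (r x + dist x y)"
      by (auto simp: dist_commute) (smt (verit) dist_triangle dist_commute)
    then have "measure m (cball x (r x)) \<le> measure m (cball y (r x + dist x y))"
      by (intro finite_measure_mono) (auto simp: sets)
    then show "P y (r x + dist x y)"
      using P_r[of x] by (auto simp: P_def)
  qed
  have "1-lipschitz_on UNIV r"
  proof (rule lipschitz_onI)
    show "dist (r x) (r y) \<le> 1 * dist x y" for x y
      using bound[of x y] bound[of y x] by (simp add: dist_real_def dist_commute)
  qed simp
  then show ?thesis by (simp add: r_def P_def)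
qed

text \<open>For \<open>p > 0\<close>, applying the increasing \<open>\<phi>\<close> turns the left
  side into \<open>1 / p \<le> \<phi> c\<close>, which rearranges because
  \<open>\<phi> c > 0\<close>. For \<open>p = 0\<close> both sides fail, the left one by the
  convention that the inverse is infinite there.\<close>

lemma inv_recip_le_iff:
  assumes \<phi>: "\<phi> \<in> class_G a b" and c: "c > 0" and p: "p \<ge> 0"
  shows "inv_recip \<phi> p \<le> ereal c \<longleftrightarrow> 1 / \<phi> c \<le> p"
proof -
  have mono: "strict_mono_on {0..} \<phi>" and img: "\<phi> ` {0..} = {0..}" and "\<phi> 0 = 0"
    using \<phi> by (auto simp: class_G_def)
  then have pos: "\<phi> c > 0"
    using c by (metis atLeast_iff less_imp_le order_refl strict_mono_onD)
  show ?thesis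
  proof (cases "p = 0")
    case True
    with pos show ?thesis by (simp add: inv_recip_def not_le)
  next
    case False
    \<comment> \<open>Surjectivity onto \<open>{0..}\<close> makes
      \<open>inv_plus \<phi> (1 / p)\<close> a genuine preimage.\<close>
    then have "1 / p \<in> \<phi> ` {0..}" using p img by simp
    then obtain u where u: "u \<ge> 0" "\<phi> u = 1 / p" by auto
    have "inv_plus \<phi> (1 / p) = u"
      unfolding inv_plus_def
      by (rule the_inv_into_f_eq[OF strict_mono_on_imp_inj_on[OF mono]]) (use u in auto)
    moreover have "u \<le> c \<longleftrightarrow> \<phi> u \<le> \<phi> c"
      using strict_mono_on_less_eq[OF mono, of u c] u(1) c by simp
    ultimately show ?thesis
      using False p pos u(2) by (simp add: inv_recip_def field_simps)
  qed
qed

theorem lemma2p1: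
  fixes m :: "'a::metric_space measure"
    and a b R :: real
    and \<phi> :: "real \<Rightarrow> real"
    and k0 :: int
  assumes "bounded (UNIV :: 'a set)"
    and "prob_space m"
    and "sets m = sets borel"
    and "measure_support m = UNIV"
    and "a \<ge> 0" and "b \<ge> 0"
    and "\<phi> \<in> class_G a b"
    and "R \<ge> 2"
    and "R powi k0 \<le> inv_plus \<phi> 1" and "inv_plus \<phi> 1 < R powi (k0 + 1)"
  shows "\<forall>k\<ge>k0. 1-lipschitz_on UNIV (radius m \<phi> R k0 k)"
proof (intro allI impI)
  fix k assume "k0 \<le> k"
  show "1-lipschitz_on UNIV (radius m \<phi> R k0 k)"
  proof (cases "k = k0")
    case True
    \<comment> \<open>At \<open>k0\<close> the radius is constant, equal to the diameter.\<close>
    then show ?thesis by (simp add: radius_def lipschitz_on_def)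
  next
    case False
    have c: "R powi k > 0" using \<open>R \<ge> 2\<close> by simp
    \<comment> \<open>Since \<open>k\<close> is at least \<open>k0 + 1\<close>, the upper bound in
      the choice of \<open>k0\<close> puts \<open>inv_plus \<phi> 1\<close> below
      \<open>R powi k\<close>. Taking \<open>p = 1\<close> in the equivalence then shows that the
      threshold \<open>1 / \<phi> (R powi k)\<close> is at most \<open>1\<close>.\<close>
    have "R powi (k0 + 1) \<le> R powi k"
      using False \<open>k0 \<le> k\<close> \<open>R \<ge> 2\<close> by (intro power_int_increasing) auto
    then have "inv_recip \<phi> 1 \<le> ereal (R powi k)"
      using assms(10) by (simp add: inv_recip_def)
    then have "1 / \<phi> (R powi k) \<le> 1"
      using inv_recip_le_iff[OF assms(7) c, of 1] by simp
    note lipschitz_least_radius[OF assms(1-3) this]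
    moreover have "radius m \<phi> R k0 k =
        (\<lambda>x. LEAST \<epsilon>. \<epsilon> \<ge> 0 \<and> 1 / \<phi> (R powi k) \<le> measure m (cball x \<epsilon>))"
      using False by (simp add: radius_def inv_recip_le_iff[OF assms(7) c] fun_eq_iff)
    ultimately show ?thesis by simp
  qed
qed

end
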